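(* Suppose the weak form of the $abc$ conjecture holds with exponent $\kappa_1$, i.e. $\kappa_1$ is a positive constant such that for every $\epsilon>0$ there are only finitely many primitive integer solutions $(A,B,C)$ of $A+B=C$ with $R(A,B,C) \le H(A,B,C)^{\kappa_1-\epsilon}$. Then for each $\epsilon>0$ there are only finitely many primitive integer solutions $(X,Y,Z)$ of $X+Y=Z$ such that \[ S(X,Y,Z) < \left(\log H(X,Y,Z)\right)^{\kappa_1-\epsilon}. \] Consequently the $xyz$-smoothness exponent satisfies $\kappa_0 \ge \kappa_1$. In particular, the strong form of the $abc$ conjecture (the weak form holding with $\kappa_1 = 1$) implies $\kappa_0 \ge 1$.
   Context: A solution $(X,Y,Z)$ of $X+Y=Z$ in integers is primitive if $\gcd(X,Y,Z)=1$. Its height is $H(X,Y,Z)=\max(|X|,|Y|,|Z|)$, its radical is $R(X,Y,Z)=\prod_{p\mid XYZ} p$, and its smoothness is $S(X,Y,Z)=\max\{p \text{ prime}: p \mid XYZ\}$. The $xyz$-smoothness exponent is \[ \kappa_0 := \liminf_{H(X,Y,Z)\to\infty,\ X+Y=Z,\ \gcd(X,Y,Z)=1} \frac{\log S(X,Y,Z)}{\log\log H(X,Y,Z)}. \] *)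

theory Defs
  imports
    Complex_Main
    "HOL-Computational_Algebra.Primes"
    "HOL-Library.Extended_Real"
    "HOL-Library.Going_To_Filter"
begin

text \<open>
  Solutions with \<open>X * Y * Z = 0\<close> are not excluded.  The primitive ones, such as
  \<open>(1, -1, 0)\<close>, all have height 1, so there are finitely many, and the values that
  \<open>radical\<close> and \<open>smoothness\<close> take on them (there the set of prime divisors is
  infinite) affect neither the finiteness assertions nor the limit inferior.
\<close>

definition primitive_solutions :: "(int \<times> int \<times> int) set" where
  "primitive_solutions = {(X, Y, Z). X + Y = Z \<and> gcd X (gcd Y Z) = 1}"

definition height :: "int \<times> int \<times> int \<Rightarrow> int" where
  "height = (\<lambda>(X, Y, Z). max \<bar>X\<bar> (max \<bar>Y\<bar> \<bar>Z\<bar>))"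

definition radical :: "int \<times> int \<times> int \<Rightarrow> int" where
  "radical = (\<lambda>(X, Y, Z). \<Prod>{p. prime p \<and> p dvd X * Y * Z})"

definition smoothness :: "int \<times> int \<times> int \<Rightarrow> int" where
  "smoothness = (\<lambda>(X, Y, Z). Max {p. prime p \<and> p dvd X * Y * Z})"

text \<open>
  The limit inferior is taken in the extended reals, so that it exists without
  any boundedness being known beforehand.
\<close>

definition xyz_smoothness_exponent :: ereal where
  "xyz_smoothness_exponent =
     Liminf (height going_to at_top within primitive_solutions)
       (\<lambda>t. ereal (ln (real_of_int (smoothness t)) / ln (ln (real_of_int (height t)))))"

definition weak_abc :: "real \<Rightarrow> bool" where
  "weak_abc \<kappa> \<longleftrightarrow> \<kappa> > 0 \<and>
     (\<forall>\<epsilon>>0. finite {t \<in> primitive_solutions.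
        real_of_int (radical t) \<le> real_of_int (height t) powr (\<kappa> - \<epsilon>)})"

definition strong_abc :: bool where
  "strong_abc \<longleftrightarrow> weak_abc 1"

end

(* A solution of smoothness S has at most S prime divisors, each at most S, so its radical is
   at most S^S. If S < (log H)^a with a < 1, then S^S = exp (o(log H)) is eventually below every
   fixed positive power of H, and the abc hypothesis applies. That a = \<kappa> - \<epsilon> is below 1 comes
   from the solutions 1 + (2^n - 1) = 2^n, of radical at most 2 H, which force \<kappa> \<le> 1. *)
theory Submission
  imports Defs "HOL-Real_Asymp.Real_Asymp"
begin

lemma finite_height_le: "finite {t. height t \<le> N}"
proof (rule finite_subset)
  show "{t. height t \<le> N} \<subseteq> {- N..N} \<times> {- N..N} \<times> {- N..N}"
    by (auto simp: height_def)
qed simp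

text \<open>On a finite set \<open>f\<close> is bounded, and \<open>no_top\<close> allows a bound
  strictly above all its values. This turns finiteness of a set of exceptions into a statement along
  the filter of the limit inferior.\<close>

lemma eventually_notin_finite_going_to:
  fixes f :: "'a \<Rightarrow> 'b :: {linorder, no_top}"
  assumes "finite B"
  shows "eventually (\<lambda>t. t \<notin> B) (f going_to at_top within A)"
proof -
  have "eventually (\<lambda>x. \<forall>t\<in>B. f t < x) at_top"
    using assms by (simp add: eventually_ball_finite eventually_gt_at_top)
  then obtain C where "\<forall>t\<in>B. f t < C"
    by (auto simp: eventually_at_top_linorder)
  then have "\<forall>t\<in>A. f t \<ge> C \<longrightarrow> t \<notin> B"
    by (metis leD)
  then show ?thesis
    unfolding eventually_going_to_at_top_linorder by blast
qed

text \<open>If one coordinate vanishes, the other two agree up to sign, so coprimality makes them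
  units and the height is 1.\<close>

lemma primitive_solution_nonzero:
  assumes "(X, Y, Z) \<in> primitive_solutions" "height (X, Y, Z) \<ge> 2"
  shows "X * Y * Z \<noteq> 0"
proof
  assume "X * Y * Z = 0"
  then consider "X = 0" "Y = Z" | "Y = 0" "X = Z" | "Z = 0" "Y = - X"
    using assms(1) by (force simp: primitive_solutions_def)
  then show False
    using assms by cases (simp_all add: primitive_solutions_def height_def)
qed

text \<open>One of X, Y, X + Y is always even. Thus \<open>Max\<close> in \<open>smoothness\<close>
  ranges over a finite nonempty set.\<close>

lemma prime_divisors_of_solution:
  assumes t: "(X, Y, Z) \<in> primitive_solutions" and h: "height (X, Y, Z) \<ge> 2"
  shows "finite {p. prime p \<and> p dvd X * Y * Z}" "2 \<in> {p. prime p \<and> p dvd X * Y * Z}"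
proof -
  have "{p. prime p \<and> p dvd X * Y * Z} = prime_factors (X * Y * Z)"
    using primitive_solution_nonzero[OF t h] by (auto simp: prime_factors_dvd)
  then show "finite {p. prime p \<and> p dvd X * Y * Z}"
    by simp
  show "2 \<in> {p. prime p \<and> p dvd X * Y * Z}"
    using t by (auto simp: primitive_solutions_def)
qed

lemma smoothness_ge_2:
  assumes "t \<in> primitive_solutions" "height t \<ge> 2"
  shows "smoothness t \<ge> 2"
  using assms prime_divisors_of_solution
  by (cases t) (auto simp: smoothness_def intro!: Max_ge)

lemma radical_le_smoothness_power:
  assumes "t \<in> primitive_solutions" "height t \<ge> 2"
  shows "radical t \<le> smoothness t ^ nat (smoothness t)"
proof -
  obtain X Y Z where t: "t = (X, Y, Z)" by (cases t)
  define P where "P = {p. prime p \<and> p dvd X * Y * Z}"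
  have fin: "finite P"
    using prime_divisors_of_solution assms unfolding t P_def by blast
  have S: "smoothness t = Max P" "radical t = \<Prod>P"
    by (simp_all add: t smoothness_def radical_def P_def)
  have le: "p \<le> smoothness t" if "p \<in> P" for p
    using fin that by (simp add: S)
  have pos: "p \<ge> 1" if "p \<in> P" for p
    using that by (auto simp: P_def prime_ge_1_int)
  \<comment> \<open>Counting all integers up to S instead of the primes costs about a factor ln S in
    the exponent of the final bound, which is harmless there.\<close>
  have "card P \<le> card {1..smoothness t}"
    using le pos by (intro card_mono) auto
  then have "card P \<le> nat (smoothness t)" by simp
  then show ?thesis
    unfolding S(2) using le pos smoothness_ge_2[OF assms]
    by (intro prod_le_power) (auto intro: order_trans[of 0 1])
qed

text \<open>Raising each prime to its multiplicity, which is at least 1, can only enlarge the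
  product.\<close>

lemma prod_prime_factors_le:
  fixes x :: int
  assumes "x \<noteq> 0"
  shows "\<Prod>(prime_factors x) \<le> \<bar>x\<bar>"
proof -
  have "\<Prod>(prime_factors x) \<le> (\<Prod>p\<in>prime_factors x. p ^ multiplicity p x)"
    by (intro prod_mono)
      (auto simp: prime_factors_multiplicity intro!: self_le_power prime_ge_0_int prime_ge_1_int)
  also have "\<dots> = \<bar>x\<bar>"
    using prod_prime_factors[OF assms] by simp
  finally show ?thesis .
qed

lemma weak_abc_exponent_le_1:
  assumes "weak_abc \<kappa>"
  shows "\<kappa> \<le> 1"
proof (rule ccontr)
  assume "\<not> \<kappa> \<le> 1"
  \<comment> \<open>Half the excess over 1: the hypothesis then applies with an exponent still above
    1.\<close>
  define \<delta> where "\<delta> = (\<kappa> - 1) / 2"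
  have \<delta>: "\<delta> > 0" "\<kappa> - \<delta> = 1 + \<delta>"
    using \<open>\<not> \<kappa> \<le> 1\<close> by (auto simp: \<delta>_def field_simps)
  define s :: "nat \<Rightarrow> int \<times> int \<times> int" where "s = (\<lambda>n. (1, 2 ^ n - 1, 2 ^ n))"
  define B where "B = {t \<in> primitive_solutions.
    real_of_int (radical t) \<le> real_of_int (height t) powr (1 + \<delta>)}"
  have "finite B"
    using assms \<delta>(1) unfolding weak_abc_def B_def \<delta>(2)[symmetric] by blast
  \<comment> \<open>For n beyond N the surplus 2 powr (n * \<delta>) absorbs the factor 2 that the
    prime 2 contributes to the radical.\<close>
  obtain N where N: "real N * \<delta> \<ge> 1"
    using \<delta>(1) by (metis reals_Archimedean3 less_imp_le)
  have "s n \<in> B" if n: "n \<ge> Suc N" for n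
  proof -
    have n1: "n \<ge> 1" using n by simp
    have prim: "s n \<in> primitive_solutions"
      by (simp add: s_def primitive_solutions_def)
    have h: "height (s n) = 2 ^ n"
      by (simp add: s_def height_def)
    have "{p::int. prime p \<and> p dvd 1 * (2 ^ n - 1) * 2 ^ n}
          = insert 2 (prime_factors (2 ^ n - 1))" (is "?L = ?R")
    proof (intro equalityI subsetI)
      fix p assume p: "p \<in> ?L"
      then consider "p dvd 2 ^ n - 1" | "p dvd 2"
        using n1 by (auto simp: prime_dvd_mult_iff prime_dvd_power_iff)
      then show "p \<in> ?R"
        using p n1 primes_dvd_imp_eq[of p 2] by cases (auto simp: prime_factors_dvd)
    next
      fix p assume "p \<in> ?R"
      then show "p \<in> ?L"
        using n1 by (auto simp: prime_factors_dvd)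
    qed
    moreover have "2 \<notin> prime_factors (2 ^ n - 1 :: int)"
      using n1 by (auto simp: prime_factors_dvd)
    ultimately have "radical (s n) = 2 * \<Prod>(prime_factors (2 ^ n - 1 :: int))"
      by (simp add: s_def radical_def)
    also have "\<Prod>(prime_factors (2 ^ n - 1 :: int)) \<le> \<bar>2 ^ n - 1\<bar>"
      using n1 by (intro prod_prime_factors_le) auto
    finally have "radical (s n) \<le> 2 * 2 ^ n"
      by simp
    then have "real_of_int (radical (s n)) \<le> 2 * 2 ^ n"
      by (metis of_int_le_iff of_int_mult of_int_numeral of_int_power)
    also have "\<dots> = 2 powr (1 + real n)"
      by (simp add: powr_add powr_realpow)
    also have "\<dots> \<le> 2 powr (real n * (1 + \<delta>))"
    proof -
      have "real N * \<delta> \<le> real n * \<delta>" using n \<delta> by (intro mult_right_mono) auto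
      then show ?thesis using N by (simp add: algebra_simps)
    qed
    also have "\<dots> = real_of_int (height (s n)) powr (1 + \<delta>)"
      by (simp add: h powr_powr flip: powr_realpow)
    finally show ?thesis
      using prim by (simp add: B_def)
  qed
  then have "s ` {Suc N..} \<subseteq> B" by auto
  moreover have "inj_on s {Suc N..}"
    by (auto simp: inj_on_def s_def)
  ultimately show False
    using \<open>finite B\<close> infinite_Ici[of "Suc N"] by (metis finite_imageD finite_subset)
qed

lemma finite_smooth_solutions:
  assumes abc: "weak_abc \<kappa>" and "\<epsilon> > 0"
  shows "finite {t \<in> primitive_solutions.
           real_of_int (smoothness t) < ln (real_of_int (height t)) powr (\<kappa> - \<epsilon>)}"
proof -
  define a where "a = \<kappa> - \<epsilon>"
  have a: "a < 1"
    using weak_abc_exponent_le_1[OF abc] \<open>\<epsilon> > 0\<close> by (simp add: a_def)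
  have \<kappa>: "\<kappa> > 0"
    using abc by (simp add: weak_abc_def)
  \<comment> \<open>Here \<open>a < 1\<close> is decisive: the left side is then o(ln x).\<close>
  have "eventually (\<lambda>x::real. a * ln (ln x) * ln x powr a \<le> \<kappa> / 2 * ln x) at_top"
    using a \<kappa> by real_asymp
  then obtain x0 where x0: "\<And>x. x \<ge> x0 \<Longrightarrow> a * ln (ln x) * ln x powr a \<le> \<kappa> / 2 * ln x"
    by (auto simp: eventually_at_top_linorder)
  \<comment> \<open>The hypothesis is applied with \<open>\<kappa> / 2\<close> in place of the given
    \<open>\<epsilon>\<close>: any fixed positive power of the height suffices.\<close>
  define A where "A = {t \<in> primitive_solutions.
    real_of_int (radical t) \<le> real_of_int (height t) powr (\<kappa> - \<kappa> / 2)}"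
  have "finite A"
    using abc \<kappa> unfolding weak_abc_def A_def by (blast intro: half_gt_zero)
  have "t \<in> A"
    if t: "t \<in> primitive_solutions" and S: "real_of_int (smoothness t) < ln (height t) powr a"
      and h: "height t > max 2 \<lceil>x0\<rceil>" for t
  proof -
    define H where "H = real_of_int (height t)"
    define s where "s = real_of_int (smoothness t)"
    have s: "s \<ge> 2"
      using smoothness_ge_2[OF t] h by (simp add: s_def)
    have H: "H > 1" "H \<ge> x0"
      using h by (auto simp: H_def ceiling_less_iff)
    have "ln s \<le> ln (ln H powr a)"
      using S s by (intro ln_mono) (auto simp: s_def H_def)
    also have "\<dots> = a * ln (ln H)"
      using H by (simp add: ln_powr)
    finally have ln_s: "ln s \<le> a * ln (ln H)" .
    have "real_of_int (radical t) \<le> real_of_int (smoothness t ^ nat (smoothness t))"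
      using radical_le_smoothness_power[OF t] h by (simp del: of_int_power)
    also have "\<dots> = s powr s"
      using s by (simp add: s_def powr_real_of_int' power_int_def)
    also have "\<dots> = exp (s * ln s)"
      using s by (simp add: powr_def)
    \<comment> \<open>Multiplying the two bounds uses \<open>ln s \<ge> 0\<close>, which comes from
      \<open>s \<ge> 2\<close>; the sign of \<open>a\<close> does not matter.\<close>
    also have "s * ln s \<le> ln H powr a * (a * ln (ln H))"
      using S s ln_s by (intro mult_mono) (auto simp: s_def H_def)
    also have "\<dots> \<le> \<kappa> / 2 * ln H"
      using x0[OF H(2)] by (simp add: mult_ac)
    also have "exp (\<kappa> / 2 * ln H) = H powr (\<kappa> - \<kappa> / 2)"
      using H by (simp add: powr_def)
    finally show ?thesis
      using t by (simp add: A_def H_def)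
  qed
  then have "{t \<in> primitive_solutions. real_of_int (smoothness t) < ln (height t) powr a}
             \<subseteq> A \<union> {t. height t \<le> max 2 \<lceil>x0\<rceil>}"
    by (blast intro: leI)
  then show ?thesis
    unfolding a_def using \<open>finite A\<close> finite_height_le finite_subset by blast
qed

lemma smoothness_exponent_ge:
  assumes fin: "\<And>\<epsilon>. \<epsilon> > 0 \<Longrightarrow> finite {t \<in> primitive_solutions.
    real_of_int (smoothness t) < ln (real_of_int (height t)) powr (\<kappa> - \<epsilon>)}"
  shows "xyz_smoothness_exponent \<ge> ereal \<kappa>"
  unfolding xyz_smoothness_exponent_def le_Liminf_iff
proof (intro allI impI)
  fix y assume "y < ereal \<kappa>"
  \<comment> \<open>The bound \<open>y\<close> may be minus infinity; a real \<open>r\<close> in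
    between yields the choice \<epsilon> = \<kappa> - r and keeps the final inequality
    strict.\<close>
  then obtain r where r: "y < ereal r" "r < \<kappa>"
    using ereal_dense2 by force
  let ?F = "height going_to at_top within primitive_solutions"
  let ?B = "{t \<in> primitive_solutions. real_of_int (smoothness t) < ln (height t) powr r}"
  have "finite ?B"
    using fin[of "\<kappa> - r"] r(2) by simp
  then have "eventually (\<lambda>t. t \<notin> ?B \<union> {t. height t \<le> 3}) ?F"
    using finite_height_le by (intro eventually_notin_finite_going_to) simp
  moreover have "eventually (\<lambda>t. t \<in> primitive_solutions) ?F"
    by (auto simp: going_to_within_def eventually_inf_principal)
  ultimately show "eventually (\<lambda>t. y < ereal (ln (smoothness t) / ln (ln (height t)))) ?F"
  proof eventually_elim
    case (elim t)
    then have h: "height t > 3" and S: "ln (height t) powr r \<le> smoothness t"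
      by auto
    \<comment> \<open>Heights up to 3 were discarded because 3 exceeds e: now ln ln H is positive,
      and dividing by it preserves the inequality.\<close>
    have "exp 1 < real_of_int (height t)"
      using h exp_le by linarith
    then have ln_h: "ln (height t) > 1"
      by (metis exp_gt_zero less_trans ln_exp ln_less_cancel_iff)
    have "r * ln (ln (height t)) = ln (ln (height t) powr r)"
      using ln_h by (simp add: ln_powr)
    also have "\<dots> \<le> ln (smoothness t)"
      using S ln_h by (intro ln_mono) auto
    finally have "r \<le> ln (smoothness t) / ln (ln (height t))"
      using ln_h by (simp add: pos_le_divide_eq)
    then show ?case
      using r(1) by (meson ereal_less_eq(3) less_le_trans)
  qed
qed

theorem theorem1p1:
  shows "(\<forall>\<kappa>\<^sub>1::real. weak_abc \<kappa>\<^sub>1 \<longrightarrow>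
            (\<forall>\<epsilon>>0. finite {t \<in> primitive_solutions.
               real_of_int (smoothness t) < ln (real_of_int (height t)) powr (\<kappa>\<^sub>1 - \<epsilon>)}) \<and>
            xyz_smoothness_exponent \<ge> ereal \<kappa>\<^sub>1) \<and>
         (strong_abc \<longrightarrow> xyz_smoothness_exponent \<ge> 1)"
  using finite_smooth_solutions smoothness_exponent_ge
  by (auto simp: strong_abc_def one_ereal_def)

end
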